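(* Let $R_n$ denote the number of $p_2$-orientations of the path $P_n$. Then $R_1=0$, $R_2=2$, $R_3=2$, $R_4=4$, and for all $n\ge 5$, $$R_n = R_{n-1}+2R_{n-2}-R_{n-4}.$$
   Context: Parallel Diffusion on a finite simple graph $G$: a configuration assigns an integer stack size $|v|$ (possibly negative) to each vertex. In one step all vertices fire simultaneously: each vertex sends one chip to each neighbour with strictly smaller stack size. Starting from $C_0$, $C_{t+1}$ is obtained from $C_t$ by one step. A configuration $D$ is a $p_2$-configuration if there are $C_0$ and $N$ such that $C_{t+2}=C_t$ and $C_{t+1}\ne C_t$ for all $t\ge N$, and $D=C_t$ for some $t\ge N$. The path $P_n$ has vertices $v_1,\dots,v_n$ and edges $e_i=v_iv_{i+1}$. A path orientation assigns to each edge either "flat" or one of its two directions. A configuration induces the path orientation in which each edge is directed from its endpoint with larger stack size to its endpoint with smaller stack size, and is flat if the stack sizes are equal. A $p_2$-orientation is a path orientation induced by some $p_2$-configuration. *)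

theory Defs
  imports Complex_Main "HOL-Library.FuncSet"
begin

definition finite_simple_graph :: "'a set \<Rightarrow> 'a set set \<Rightarrow> bool" where
  "finite_simple_graph V E \<longleftrightarrow> finite V \<and> (\<forall>e\<in>E. e \<subseteq> V \<and> card e = 2)"

definition neighbours :: "'a set \<Rightarrow> 'a set set \<Rightarrow> 'a \<Rightarrow> 'a set" where
  "neighbours V E v = {u \<in> V. {u, v} \<in> E}"

(* Extensional functions, so that equality of configurations is equality on the vertices. *)
definition configurations :: "'a set \<Rightarrow> ('a \<Rightarrow> int) set" where
  "configurations V = V \<rightarrow>\<^sub>E UNIV"

(* A vertex loses one chip for each poorer neighbour, and receives one from each richer neighbour. *)
definition diffusion_step :: "'a set \<Rightarrow> 'a set set \<Rightarrow> ('a \<Rightarrow> int) \<Rightarrow> 'a \<Rightarrow> int" where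
  "diffusion_step V E C = (\<lambda>v\<in>V. C v
      - int (card {u \<in> neighbours V E v. C u < C v})
      + int (card {u \<in> neighbours V E v. C v < C u}))"

definition diffusion :: "'a set \<Rightarrow> 'a set set \<Rightarrow> ('a \<Rightarrow> int) \<Rightarrow> nat \<Rightarrow> 'a \<Rightarrow> int" where
  "diffusion V E C\<^sub>0 t = (diffusion_step V E ^^ t) C\<^sub>0"

definition p2_configuration :: "'a set \<Rightarrow> 'a set set \<Rightarrow> ('a \<Rightarrow> int) \<Rightarrow> bool" where
  "p2_configuration V E D \<longleftrightarrow>
    (\<exists>C\<^sub>0 \<in> configurations V. \<exists>N.
      (\<forall>t\<ge>N. diffusion V E C\<^sub>0 (t + 2) = diffusion V E C\<^sub>0 t \<and>
             diffusion V E C\<^sub>0 (t + 1) \<noteq> diffusion V E C\<^sub>0 t) \<and>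
      (\<exists>t\<ge>N. D = diffusion V E C\<^sub>0 t))"

definition path_vertices :: "nat \<Rightarrow> nat set" where
  "path_vertices n = {1..n}"

definition path_edges :: "nat \<Rightarrow> nat set set" where
  "path_edges n = (\<lambda>i. {i, i + 1}) ` {1..<n}"

(* The edge joining i and i + 1 is represented by its index i;
   Forward directs it from i to i + 1, Backward from i + 1 to i. *)
datatype edge_orientation = Flat | Forward | Backward

definition path_orientations :: "nat \<Rightarrow> (nat \<Rightarrow> edge_orientation) set" where
  "path_orientations n = {1..<n} \<rightarrow>\<^sub>E UNIV"

definition induced_orientation :: "nat \<Rightarrow> (nat \<Rightarrow> int) \<Rightarrow> nat \<Rightarrow> edge_orientation" where
  "induced_orientation n C = (\<lambda>i\<in>{1..<n}.
     if C i > C (i + 1) then Forward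
     else if C i < C (i + 1) then Backward
     else Flat)"

definition p2_orientations :: "nat \<Rightarrow> (nat \<Rightarrow> edge_orientation) set" where
  "p2_orientations n = {d \<in> path_orientations n.
     \<exists>D. p2_configuration (path_vertices n) (path_edges n) D \<and> d = induced_orientation n D}"

definition num_p2_orientations :: "nat \<Rightarrow> nat" where
  "num_p2_orientations n = card (p2_orientations n)"

lemma finite_simple_graph_path: "finite_simple_graph (path_vertices n) (path_edges n)"
  by (auto simp: finite_simple_graph_def path_vertices_def path_edges_def)

lemma diffusion_in_configurations:
  "C \<in> configurations V \<Longrightarrow> diffusion V E C t \<in> configurations V"
  by (cases t) (auto simp: diffusion_def configurations_def diffusion_step_def)

lemma induced_orientation_in_path_orientations: "induced_orientation n C \<in> path_orientations n"
  by (auto simp: induced_orientation_def path_orientations_def)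

lemma finite_p2_orientations: "finite (p2_orientations n)"
proof -
  have "(UNIV :: edge_orientation set) = {Flat, Forward, Backward}"
    using edge_orientation.exhaust by blast
  then have "finite (UNIV :: edge_orientation set)"
    by (metis finite.emptyI finite.insertI)
  then have "finite (path_orientations n)"
    unfolding path_orientations_def by (intro finite_PiE) auto
  then show ?thesis
    by (simp add: p2_orientations_def)
qed

end

theory Submission
  imports Defs
begin

text \<open>
  On a path the stack differences along the edges can be prescribed freely. If \<open>f i\<close> is the signed
  flow along edge \<open>i\<close>, with \<open>f 0 = f n = 0\<close>, then a configuration has period two iff the flow is
  nonzero and reverses in one step. A step changes the difference along edge \<open>i\<close> by
  \<open>f (i - 1) - 2 * f i + f (i + 1)\<close>, so nonzero differences of absolute value one are the
  easiest to reverse, and the induced orientations are characterised by a condition on three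
  consecutive edges. Words subject to such a condition are counted by a transfer matrix; up to
  reversing all directions it has four states, and eliminating three of the four resulting
  sequences gives the recurrence.
\<close>

fun flow :: "edge_orientation \<Rightarrow> int" where
  "flow Flat = 0"
| "flow Forward = 1"
| "flow Backward = - 1"

text \<open>An edge with difference x of sign \<open>flow b\<close> has difference x +
  \<open>flow a\<close> - 2 * \<open>flow b\<close> + \<open>flow c\<close> after one step. The
  clauses say that some such x is reversed; for nonzero \<open>flow b\<close> this happens iff it
  happens for x = \<open>flow b\<close>.\<close>

fun reversible :: "edge_orientation \<Rightarrow> edge_orientation \<Rightarrow> edge_orientation \<Rightarrow> bool" where
  "reversible a Flat c \<longleftrightarrow> flow a + flow c = 0"
| "reversible a Forward c \<longleftrightarrow> flow a + flow c \<le> 0"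
| "reversible a Backward c \<longleftrightarrow> flow a + flow c \<ge> 0"

text \<open>Virtual flat edges 0 and n carry no flow, so the two end vertices need no separate
  treatment.\<close>

definition padded :: "nat \<Rightarrow> (nat \<Rightarrow> edge_orientation) \<Rightarrow> nat \<Rightarrow> edge_orientation" where
  "padded n d i = (if i \<in> {1..<n} then d i else Flat)"

abbreviation path_step :: "nat \<Rightarrow> (nat \<Rightarrow> int) \<Rightarrow> nat \<Rightarrow> int" where
  "path_step n \<equiv> diffusion_step (path_vertices n) (path_edges n)"

abbreviation path_flow :: "nat \<Rightarrow> (nat \<Rightarrow> int) \<Rightarrow> nat \<Rightarrow> int" where
  "path_flow n C i \<equiv> flow (padded n (induced_orientation n C) i)"

lemma flow_eq_0_iff [simp]: "flow a = 0 \<longleftrightarrow> a = Flat"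
  by (cases a) auto

section \<open>Configurations of period two\<close>

text \<open>The process is deterministic, so \<open>D\<close> itself can serve as the initial
  configuration with \<open>N = 0\<close>; only its next two steps matter.\<close>

lemma p2_configuration_iff:
  "p2_configuration V E D \<longleftrightarrow>
    D \<in> configurations V \<and> diffusion_step V E (diffusion_step V E D) = D \<and> diffusion_step V E D \<noteq> D"
  (is "_ \<longleftrightarrow> ?R")
proof
  assume "p2_configuration V E D"
  then obtain C N t where C: "C \<in> configurations V" and "N \<le> t" and D: "D = diffusion V E C t"
    and "\<forall>t\<ge>N. diffusion V E C (t + 2) = diffusion V E C t \<and>
             diffusion V E C (t + 1) \<noteq> diffusion V E C t"
    unfolding p2_configuration_def by blast
  then have "diffusion V E C (t + 2) = diffusion V E C t"
    "diffusion V E C (t + 1) \<noteq> diffusion V E C t" by auto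
  then show ?R
    using diffusion_in_configurations[OF C, of E t] unfolding D by (simp add: diffusion_def)
next
  assume R: ?R
  have even_odd: "diffusion V E D (2 * k) = D \<and> diffusion V E D (2 * k + 1) = diffusion_step V E D" for k
    using R by (induction k) (auto simp: diffusion_def)
  have "diffusion V E D (t + 2) = diffusion V E D t \<and> diffusion V E D (t + 1) \<noteq> diffusion V E D t" for t
  proof (cases "even t")
    case True
    then obtain k where t: "t = 2 * k" by (elim evenE)
    show ?thesis using even_odd[of k] even_odd[of "Suc k"] R unfolding t by auto
  next
    case False
    then obtain k where t: "t = 2 * k + 1" by (elim oddE)
    show ?thesis using even_odd[of k] even_odd[of "Suc k"] R unfolding t by auto
  qed
  moreover have "D = diffusion V E D 0"
    by (simp add: diffusion_def)
  ultimately show "p2_configuration V E D"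
    using R unfolding p2_configuration_def by blast
qed

section \<open>The signed flow along the edges of a path\<close>

lemma path_flow_eq:
  "path_flow n C i = (if i \<in> {1..<n} then sgn (C i - C (i + 1)) else 0)"
  by (simp add: padded_def induced_orientation_def)

lemma neighbours_path:
  "i \<in> {1..n} \<Longrightarrow> neighbours (path_vertices n) (path_edges n) i
    = {u. u \<in> {1..n} \<and> (Suc u = i \<or> u = Suc i)}"
  unfolding neighbours_def path_vertices_def path_edges_def
  by (auto simp: doubleton_eq_iff image_iff)

lemma path_step_eq:
  assumes i: "i \<in> {1..n}"
  shows "path_step n C i = C i + path_flow n C (i - 1) - path_flow n C i"
proof -
  \<comment> \<open>For \<open>i = 1\<close> the index \<open>i - 1\<close> is 0, outside
    \<open>{1..<n}\<close>, so the missing left neighbour contributes nothing; the missing right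
    neighbour of \<open>n\<close> is excluded likewise.\<close>
  have card_split: "card {u \<in> neighbours (path_vertices n) (path_edges n) i. P u} =
     (if i - 1 \<in> {1..<n} \<and> P (i - 1) then 1 else 0) + (if i \<in> {1..<n} \<and> P (i + 1) then 1 else 0)" for P
  proof -
    have "{u \<in> neighbours (path_vertices n) (path_edges n) i. P u} =
      (if i - 1 \<in> {1..<n} \<and> P (i - 1) then {i - 1} else {}) \<union>
      (if i \<in> {1..<n} \<and> P (i + 1) then {i + 1} else {})"
      unfolding neighbours_path[OF i] using i by (auto split: if_splits)
    then show ?thesis by simp
  qed
  have step: "path_step n C i = C i
      - int (card {u \<in> neighbours (path_vertices n) (path_edges n) i. C u < C i})
      + int (card {u \<in> neighbours (path_vertices n) (path_edges n) i. C i < C u})"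
    using i by (simp add: diffusion_step_def path_vertices_def)
  have "i - 1 + 1 = i" using i by auto
  then show ?thesis
    unfolding step card_split path_flow_eq by (simp add: sgn_if)
qed

lemma path_step_outside: "i \<notin> {1..n} \<Longrightarrow> path_step n C i = undefined"
  by (auto simp: diffusion_step_def path_vertices_def)

text \<open>A path has no cycles: the flow on edge 0 vanishes, and an unchanged stack at a vertex
  forces equal flow on its two sides, so zero propagates from left to right.\<close>

lemma path_step_fixed_iff:
  assumes C: "C \<in> configurations (path_vertices n)"
  shows "path_step n C = C \<longleftrightarrow> (\<forall>i. path_flow n C i = 0)"
proof
  assume fixed: "path_step n C = C"
  show "\<forall>i. path_flow n C i = 0"
  proof
    fix i
    show "path_flow n C i = 0"
    proof (induction i)
      case 0
      show ?case by (simp add: padded_def)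
    next
      case (Suc i)
      show ?case
      proof (cases "Suc i \<in> {1..n}")
        case True
        from path_step_eq[OF True, of C] fixed Suc.IH show ?thesis by simp
      qed (simp add: padded_def)
    qed
  qed
next
  assume zero: "\<forall>i. path_flow n C i = 0"
  show "path_step n C = C"
  proof
    fix i
    show "path_step n C i = C i"
    proof (cases "i \<in> {1..n}")
      case True
      then show ?thesis using zero path_step_eq[OF True, of C] by simp
    next
      case False
      then show ?thesis
        \<comment> \<open>Off the vertices both sides are \<open>undefined\<close>.\<close>
        using C path_step_outside[OF False, of C]
        by (auto simp: configurations_def path_vertices_def PiE_def extensional_def)
    qed
  qed
qed

text \<open>The propagation argument for fixed configurations, applied to the sum of the flows of
  two successive steps.\<close>

lemma path_step_twice_iff:
  assumes C: "C \<in> configurations (path_vertices n)"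
  shows "path_step n (path_step n C) = C \<longleftrightarrow>
    (\<forall>i. path_flow n (path_step n C) i = - path_flow n C i)"
proof
  assume fixed: "path_step n (path_step n C) = C"
  show "\<forall>i. path_flow n (path_step n C) i = - path_flow n C i"
  proof
    fix i
    show "path_flow n (path_step n C) i = - path_flow n C i"
    proof (induction i)
      case 0
      show ?case by (simp add: padded_def)
    next
      case (Suc i)
      show ?case
      proof (cases "Suc i \<in> {1..n}")
        case True
        from path_step_eq[OF True, of C] path_step_eq[OF True, of "path_step n C"] fixed Suc.IH
        show ?thesis by simp
      qed (simp add: padded_def)
    qed
  qed
next
  assume rev: "\<forall>i. path_flow n (path_step n C) i = - path_flow n C i"
  show "path_step n (path_step n C) = C"
  proof
    fix i
    show "path_step n (path_step n C) i = C i"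
    proof (cases "i \<in> {1..n}")
      case True
      from path_step_eq[OF True, of C] path_step_eq[OF True, of "path_step n C"] rev
      show ?thesis by simp
    next
      case False
      then show ?thesis
        using C path_step_outside[OF False, of "path_step n C"]
        by (auto simp: configurations_def path_vertices_def PiE_def extensional_def)
    qed
  qed
qed

section \<open>Reversal as a condition on three consecutive edges\<close>

lemma path_step_difference:
  assumes "i \<in> {1..<n}"
  shows "path_step n C i - path_step n C (i + 1) =
    C i - C (i + 1) + path_flow n C (i - 1) - 2 * path_flow n C i + path_flow n C (i + 1)"
  using path_step_eq[of i n C] path_step_eq[of "i + 1" n C] assms by simp

text \<open>Necessity for a difference of any size: if \<open>b = Forward\<close>, then x \<ge> 1
  and x - 2 + \<open>flow a\<close> + \<open>flow c\<close> < 0 leave only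
  \<open>flow a + flow c\<close> \<le> 0. The converse below takes x =
  \<open>flow b\<close>.\<close>

lemma reversible_if_sgn_eq:
  assumes "sgn x = flow b" "sgn (x + flow a - 2 * flow b + flow c) = - flow b"
  shows "reversible a b c"
  using assms by (cases b) (auto simp: sgn_if split: if_splits)

lemma sgn_eq_if_reversible:
  assumes "reversible a b c"
  shows "sgn (flow b + flow a - 2 * flow b + flow c) = - flow b"
  using assms by (cases b) (auto simp: sgn_if)

definition reversible_orientation :: "nat \<Rightarrow> (nat \<Rightarrow> edge_orientation) \<Rightarrow> bool" where
  "reversible_orientation n d \<longleftrightarrow>
    (\<forall>i\<in>{1..<n}. reversible (padded n d (i - 1)) (padded n d i) (padded n d (i + 1)))"

lemma reversible_orientation_if_p2_configuration:
  assumes "p2_configuration (path_vertices n) (path_edges n) D"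
  shows "reversible_orientation n (induced_orientation n D)"
proof -
  let ?D' = "path_step n D"
  from assms have rev: "path_flow n ?D' i = - path_flow n D i" for i
    using path_step_twice_iff by (auto simp: p2_configuration_iff)
  show ?thesis
    unfolding reversible_orientation_def
  proof
    fix i assume i: "i \<in> {1..<n}"
    have sgn: "sgn (D i - D (i + 1)) = path_flow n D i"
      using i by (simp only: path_flow_eq if_True)
    have "sgn (?D' i - ?D' (i + 1)) = - path_flow n D i"
      using rev[of i] i by (simp only: path_flow_eq[of n ?D'] if_True)
    then show "reversible (padded n (induced_orientation n D) (i - 1))
      (padded n (induced_orientation n D) i) (padded n (induced_orientation n D) (i + 1))"
      unfolding path_step_difference[OF i] by (rule reversible_if_sgn_eq[OF sgn])
  qed
qed

lemma p2_configuration_if_reversible_orientation: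
  assumes d: "d \<in> path_orientations n" and rev: "reversible_orientation n d"
    and nonflat: "\<exists>i\<in>{1..<n}. d i \<noteq> Flat"
  shows "\<exists>D. p2_configuration (path_vertices n) (path_edges n) D \<and> d = induced_orientation n D"
proof -
  \<comment> \<open>Negated partial sums make the drop from \<open>i\<close> to \<open>i + 1\<close>
    exactly \<open>flow (d i)\<close>, the smallest difference inducing \<open>d i\<close>. Negative
    stacks are allowed, so vertex 1 may start at 0.\<close>
  define D where "D = (\<lambda>i\<in>path_vertices n. - (\<Sum>j\<in>{1..<i}. flow (d j)))"
  have D: "D \<in> configurations (path_vertices n)"
    by (auto simp: D_def configurations_def)
  have diff: "D i - D (i + 1) = flow (d i)" if "i \<in> {1..<n}" for i
    using that by (simp add: D_def path_vertices_def)
  have induced: "d = induced_orientation n D"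
  proof
    fix i
    show "d i = induced_orientation n D i"
    proof (cases "i \<in> {1..<n}")
      case True
      then show ?thesis
        using diff[OF True] unfolding induced_orientation_def restrict_apply'[OF True]
        by (cases "d i") simp_all
    next
      case False
      then show ?thesis
        using d PiE_arb[of d "{1..<n}" "\<lambda>_. UNIV" i]
        by (simp only: induced_orientation_def path_orientations_def restrict_apply if_False not_False_eq_True)
    qed
  qed
  have "path_flow n (path_step n D) i = - path_flow n D i" for i
  proof (cases "i \<in> {1..<n}")
    case True
    have "path_flow n (path_step n D) i = sgn (path_step n D i - path_step n D (i + 1))"
      using True by (simp only: path_flow_eq if_True)
    also have "\<dots> = sgn (path_flow n D i + path_flow n D (i - 1)
        - 2 * path_flow n D i + path_flow n D (i + 1))"
      unfolding path_step_difference[OF True] diff[OF True] induced[symmetric]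
      using True by (simp add: padded_def)
    also have "\<dots> = - path_flow n D i"
      using rev True unfolding reversible_orientation_def induced[symmetric]
      by (intro sgn_eq_if_reversible) blast
    finally show ?thesis .
  qed (auto simp: padded_def)
  moreover have "\<not> (\<forall>i. path_flow n D i = 0)"
  proof -
    from nonflat obtain i where "i \<in> {1..<n}" "d i \<noteq> Flat" by blast
    then have "path_flow n D i \<noteq> 0"
      unfolding induced[symmetric] by (simp add: padded_def)
    then show ?thesis by blast
  qed
  ultimately have "p2_configuration (path_vertices n) (path_edges n) D"
    unfolding p2_configuration_iff path_step_twice_iff[OF D] path_step_fixed_iff[OF D]
    by (intro conjI allI D)
  with induced show ?thesis by (intro exI[of _ D] conjI)
qed

text \<open>The flat orientation satisfies the local condition too, but it is induced only by fixed
  configurations and has to be removed.\<close>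

lemma p2_orientations_eq:
  "p2_orientations n =
    {d \<in> path_orientations n. reversible_orientation n d \<and> (\<exists>i\<in>{1..<n}. d i \<noteq> Flat)}"
proof -
  have "\<exists>i\<in>{1..<n}. induced_orientation n D i \<noteq> Flat"
    if "p2_configuration (path_vertices n) (path_edges n) D" for D
    using that path_step_fixed_iff[of D n]
    by (auto simp: p2_configuration_iff padded_def split: if_splits)
  then show ?thesis
    unfolding p2_orientations_def
    using reversible_orientation_if_p2_configuration p2_configuration_if_reversible_orientation
    by blast
qed

section \<open>Counting by a transfer matrix\<close>

text \<open>The state \<open>a\<close>, \<open>b\<close> holds the last two letters read. The empty
  word still has to test the last edge, against the virtual flat edge after it.\<close>

fun reversible_list :: "edge_orientation \<Rightarrow> edge_orientation \<Rightarrow> edge_orientation list \<Rightarrow> bool" where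
  "reversible_list a b [] \<longleftrightarrow> reversible a b Flat"
| "reversible_list a b (x # xs) \<longleftrightarrow> reversible a b x \<and> reversible_list b x xs"

definition extensions :: "edge_orientation \<Rightarrow> edge_orientation \<Rightarrow> nat \<Rightarrow> edge_orientation list set" where
  "extensions a b m = {xs. length xs = m \<and> reversible_list a b xs}"

definition num_extensions :: "edge_orientation \<Rightarrow> edge_orientation \<Rightarrow> nat \<Rightarrow> nat" where
  "num_extensions a b m = card (extensions a b m)"

lemma reversible_list_map_iff:
  assumes "i < n" "1 \<le> i"
  shows "reversible_list (padded n d (i - 1)) (padded n d i) (map d [Suc i..<n]) \<longleftrightarrow>
    (\<forall>j\<in>{i..<n}. reversible (padded n d (j - 1)) (padded n d j) (padded n d (j + 1)))"
proof -
  obtain m where n: "n = Suc m" and "i \<le> m"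
    using assms by (cases n) auto
  \<comment> \<open>Downward induction from the last edge \<open>m = n - 1\<close>, where the
    remaining word is empty.\<close>
  from \<open>i \<le> m\<close> \<open>1 \<le> i\<close> show ?thesis
  proof (induction rule: inc_induct)
    case base
    then show ?case by (simp add: n padded_def)
  next
    case (step k)
    have "[Suc k..<n] = Suc k # [Suc (Suc k)..<n]" "{k..<n} = insert k {Suc k..<n}"
      "padded n d (Suc k) = d (Suc k)"
      using step.hyps step.prems n by (auto simp: upt_rec padded_def)
    then show ?case using step by simp
  qed
qed

text \<open>A flat edge needs opposite flows on its two sides, so two adjacent flat letters force a
  third. Since edge 0 is flat, only the all-flat word can begin with \<open>Flat\<close>.\<close>

lemma flat_if_reversible_list:
  "reversible_list Flat Flat xs \<Longrightarrow> set xs \<subseteq> {Flat}"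
  by (induction xs) auto

section \<open>Orientations as words over three letters\<close>

lemma bij_betw_path_orientations_lists:
  "bij_betw (\<lambda>d. map d [1..<n]) (path_orientations n) {xs. length xs = n - 1}"
proof (rule bij_betw_imageI)
  show "inj_on (\<lambda>d. map d [1..<n]) (path_orientations n)"
    unfolding path_orientations_def by (rule inj_onI, erule PiE_ext) auto
  show "(\<lambda>d. map d [1..<n]) ` path_orientations n = {xs. length xs = n - 1}"
  proof (intro equalityI subsetI)
    fix xs :: "edge_orientation list" assume "xs \<in> {xs. length xs = n - 1}"
    then have xs: "xs = map (\<lambda>i\<in>{1..<n}. xs ! (i - 1)) [1..<n]"
      by (intro nth_equalityI) auto
    show "xs \<in> (\<lambda>d. map d [1..<n]) ` path_orientations n"
      by (rule image_eqI, rule xs) (simp add: path_orientations_def)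
  qed auto
qed

text \<open>A path on m + 2 vertices has m + 1 edges; the first is directed, and the other m form an
  extension of the state reached after it.\<close>

lemma p2_orientations_lists:
  "(\<lambda>d. map d [1..<m + 2]) ` p2_orientations (m + 2) =
    Cons Forward ` extensions Flat Forward m \<union> Cons Backward ` extensions Flat Backward m"
  (is "?f ` _ = ?W")
proof -
  have iff: "reversible_orientation (m + 2) d \<and> (\<exists>i\<in>{1..<m + 2}. d i \<noteq> Flat) \<longleftrightarrow> ?f d \<in> ?W" for d
  proof -
    have f: "?f d = d 1 # map d [2..<m + 2]"
      by (subst upt_conv_Cons) (auto simp: numeral_2_eq_2 simp del: upt_Suc)
    have rev: "reversible_orientation (m + 2) d \<longleftrightarrow> reversible_list Flat (d 1) (map d [2..<m + 2])"
      using reversible_list_map_iff[of 1 "m + 2" d]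
      by (simp add: reversible_orientation_def padded_def numeral_2_eq_2 del: upt_Suc)
    have set_f: "(\<exists>i\<in>{1..<m + 2}. d i \<noteq> Flat) \<longleftrightarrow> \<not> set (?f d) \<subseteq> {Flat}"
      by (auto simp del: upt_Suc)
    have mem: "x # ys \<in> ?W \<longleftrightarrow> x \<noteq> Flat \<and> reversible_list Flat x ys"
      if "length ys = m" for x ys
      using that by (cases x) (auto simp: extensions_def)
    have nonflat: "reversible_list Flat x ys \<and> \<not> set (x # ys) \<subseteq> {Flat} \<longleftrightarrow>
      x \<noteq> Flat \<and> reversible_list Flat x ys" for x ys
      using flat_if_reversible_list[of ys] by (cases x) auto
    show ?thesis
      unfolding rev set_f unfolding f nonflat by (subst mem) (simp_all del: upt_Suc)
  qed
  \<comment> \<open>Membership in the set to be mapped depends only on the word, so surjectivity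
    onto words of the right length suffices.\<close>
  have restrict: "f ` {d \<in> P. f d \<in> W} = W" if "W \<subseteq> f ` P"
    for W and P :: "(nat \<Rightarrow> edge_orientation) set" and f :: "_ \<Rightarrow> edge_orientation list"
    using that by blast
  have "?W \<subseteq> {xs. length xs = m + 2 - 1}"
    by (auto simp: extensions_def)
  also have "\<dots> = ?f ` path_orientations (m + 2)"
    using bij_betw_path_orientations_lists[of "m + 2"] by (simp add: bij_betw_def)
  finally show ?thesis
    unfolding p2_orientations_eq iff by (rule restrict)
qed

section \<open>Recurrences for the numbers of extensions\<close>

lemma UNIV_edge_orientation: "UNIV = {Flat, Forward, Backward}"
  using edge_orientation.exhaust by blast

lemma finite_extensions: "finite (extensions a b m)"
proof -
  have "finite {xs. set xs \<subseteq> (UNIV :: edge_orientation set) \<and> length xs = m}"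
    by (rule finite_lists_length_eq) (simp add: UNIV_edge_orientation)
  then show ?thesis
    by (rule rev_finite_subset) (auto simp: extensions_def)
qed

lemma num_extensions_0: "num_extensions a b 0 = (if reversible a b Flat then 1 else 0)"
proof -
  have "extensions a b 0 = (if reversible a b Flat then {[]} else {})"
    by (auto simp: extensions_def)
  then show ?thesis by (simp add: num_extensions_def)
qed

lemma num_extensions_Suc:
  "num_extensions a b (Suc m) = (if reversible a b Flat then num_extensions b Flat m else 0)
    + (if reversible a b Forward then num_extensions b Forward m else 0)
    + (if reversible a b Backward then num_extensions b Backward m else 0)"
proof -
  let ?S = "\<lambda>x. if reversible a b x then Cons x ` extensions b x m else {}"
  have "extensions a b (Suc m) = (\<Union>x\<in>{Flat, Forward, Backward}. ?S x)"
    unfolding UNIV_edge_orientation[symmetric]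
    by (auto simp: extensions_def length_Suc_conv split: if_splits)
  also have "card \<dots> = (\<Sum>x\<in>{Flat, Forward, Backward}. card (?S x))"
    by (rule card_UN_disjoint) (auto simp: finite_extensions)
  also have "\<dots> = (\<Sum>x\<in>{Flat, Forward, Backward}. if reversible a b x then num_extensions b x m else 0)"
    by (intro sum.cong) (auto simp: num_extensions_def card_image)
  finally show ?thesis
    by (simp add: num_extensions_def)
qed

fun opposite :: "edge_orientation \<Rightarrow> edge_orientation" where
  "opposite Flat = Flat"
| "opposite Forward = Backward"
| "opposite Backward = Forward"

text \<open>Reversing all directions negates every flow and preserves \<open>reversible\<close>.
  This identifies mirror states and leaves only those with a \<open>Forward\<close> letter first
  among the directed ones.\<close>

lemma num_extensions_opposite:
  "num_extensions (opposite a) (opposite b) m = num_extensions a b m"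
proof (induction m arbitrary: a b)
  case 0
  show ?case by (cases a; cases b) (simp_all add: num_extensions_0)
next
  case (Suc m)
  show ?case
    using Suc.IH[of b Flat] Suc.IH[of b Forward] Suc.IH[of b Backward]
    by (cases a; cases b) (simp_all add: num_extensions_Suc)
qed

lemma num_p2_orientations_eq: "num_p2_orientations (m + 2) = 2 * num_extensions Flat Forward m"
proof -
  have "inj_on (\<lambda>d. map d [1..<m + 2]) (p2_orientations (m + 2))"
    using bij_betw_path_orientations_lists[of "m + 2"]
    by (rule inj_on_subset[OF bij_betw_imp_inj_on]) (auto simp: p2_orientations_def)
  then have "num_p2_orientations (m + 2) = card (Cons Forward ` extensions Flat Forward m \<union>
      Cons Backward ` extensions Flat Backward m)"
    unfolding num_p2_orientations_def p2_orientations_lists[symmetric] by (simp add: card_image)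
  also have "\<dots> = num_extensions Flat Forward m + num_extensions Flat Backward m"
    unfolding num_extensions_def
    by (subst card_Un_disjoint) (auto simp: finite_extensions card_image)
  also have "\<dots> = 2 * num_extensions Flat Forward m"
    using num_extensions_opposite[of Flat Forward m] by simp
  finally show ?thesis .
qed

text \<open>These four states are closed under reading a letter, up to \<open>opposite\<close>; the
  state \<open>Flat\<close>, \<open>Flat\<close> is never reached from them.\<close>

lemma num_extensions_Suc_states:
  "num_extensions Flat Forward (Suc m) = num_extensions Forward Flat m + num_extensions Forward Backward m"
  "num_extensions Forward Flat (Suc m) = num_extensions Flat Forward m"
  "num_extensions Forward Backward (Suc m) = num_extensions Forward Backward m
    + num_extensions Forward Flat m + num_extensions Forward Forward m"
  "num_extensions Forward Forward (Suc m) = num_extensions Forward Backward m"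
  using num_extensions_opposite[of Flat Forward m] num_extensions_opposite[of Forward Backward m]
    num_extensions_opposite[of Forward Flat m] num_extensions_opposite[of Forward Forward m]
  by (simp_all add: num_extensions_Suc)

lemma num_p2_orientations_1: "num_p2_orientations 1 = 0"
  by (simp add: num_p2_orientations_def p2_orientations_eq)

lemma num_p2_orientations_small:
  "num_p2_orientations 2 = 2" "num_p2_orientations 3 = 2"
  "num_p2_orientations 4 = 4" "num_p2_orientations 5 = 8"
proof -
  have "num_extensions Flat Forward 0 = 1" "num_extensions Flat Forward 1 = 1"
    "num_extensions Flat Forward 2 = 2" "num_extensions Flat Forward 3 = 4"
    by (simp_all add: numeral_2_eq_2 numeral_3_eq_3 num_extensions_Suc_states num_extensions_0)
  then show "num_p2_orientations 2 = 2" "num_p2_orientations 3 = 2"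
    "num_p2_orientations 4 = 4" "num_p2_orientations 5 = 8"
    using num_p2_orientations_eq[of 0, unfolded add_0] num_p2_orientations_eq[of 1]
      num_p2_orientations_eq[of 2] num_p2_orientations_eq[of 3]
    by (simp_all del: One_nat_def)
qed

text \<open>With p, q, r, s the values at \<open>m\<close> of the four states in the order listed
  above, both sides expand to 3p + 4q + 5r + 3s. The negative term stands on the left to avoid
  subtraction in the naturals.\<close>

lemma num_extensions_recurrence:
  "num_extensions Flat Forward (Suc (Suc (Suc (Suc m)))) + num_extensions Flat Forward m =
    num_extensions Flat Forward (Suc (Suc (Suc m))) + 2 * num_extensions Flat Forward (Suc (Suc m))"
  by (simp add: num_extensions_Suc_states)

theorem theorem3:
  shows "num_p2_orientations 1 = 0 \<and>
         num_p2_orientations 2 = 2 \<and>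
         num_p2_orientations 3 = 2 \<and>
         num_p2_orientations 4 = 4 \<and>
         (\<forall>n\<ge>5. int (num_p2_orientations n) =
             int (num_p2_orientations (n - 1)) + 2 * int (num_p2_orientations (n - 2))
             - int (num_p2_orientations (n - 4)))"
proof -
  have "int (num_p2_orientations n) =
      int (num_p2_orientations (n - 1)) + 2 * int (num_p2_orientations (n - 2))
      - int (num_p2_orientations (n - 4))" if "n \<ge> 5" for n
  \<comment> \<open>Here \<open>n - 4 = 1\<close> is a path without edges, which the formula for m +
    2 vertices does not cover; the computed values give 8 = 4 + 2 * 2 - 0.\<close>
  proof (cases "n = 5")
    case True
    then show ?thesis
      using num_p2_orientations_1 num_p2_orientations_small by simp
  next
    case False
    define m where "m = n - 6"
    have "n = Suc (Suc (Suc (Suc m))) + 2" "n - 1 = Suc (Suc (Suc m)) + 2"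
      "n - 2 = Suc (Suc m) + 2" "n - 4 = m + 2"
      using that False by (auto simp: m_def)
    then show ?thesis
      using num_extensions_recurrence[of m] by (simp only: num_p2_orientations_eq)
  qed
  then show ?thesis
    using num_p2_orientations_1 num_p2_orientations_small by blast
qed

end
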